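(* Let $k\ge1$, let $G=(V,E)$ be a finite $(k+1)$-claw free graph with positive vertex weights $w$, let $O$ be a maximum-weight independent set of $G$ and let $A$ be an independent set of $G$ with $N(o,A)\neq\emptyset$ for all $o\in O$. If $A$ is locally optimal under $s$-exchanges for some $s\ge 1+2k(k-1)$, then for any $0\le\epsilon\le1/2$, $$w(O)\le\left[\frac{k+1}{2}-\frac12\min\left\{\frac{2(1-\epsilon)}{3-\epsilon},\ \rho_k,\ 2-\frac{1}{\sqrt{1-\epsilon}}\right\}\right]w(A),$$ where $\rho_k=\big(k-1/\sqrt{1-\epsilon}\big)\big(1-\sqrt{1-\epsilon}\big)$.
   Context: A graph is $(k+1)$-claw free if it has no induced subgraph consisting of a vertex adjacent to $k+1$ pairwise non-adjacent vertices. For $X\subseteq V$, $w(X)=\sum_{v\in X}w_v$, $w^2(X)=\sum_{v\in X}w_v^2$. For $X,Y\subseteq V$, $N(X,Y)=\{y\in Y: y\text{ adjacent to some }x\in X\}\cup(X\cap Y)$, $N(v,Y)=N(\{v\},Y)$, $A-a=A\setminus\{a\}$. For $o\in O$, $\pi(o)$ is a vertex of $N(o,A)$ of maximum weight (ties broken arbitrarily but consistently). For $a\in A$: $C_a=\{o\in O:\pi(o)=a\}$ and $N^+_a=\{a\}\cup\bigcup_{o\in C_a}N(o,A-a)$. $A$ is locally optimal under $s$-exchanges if for every $X\subseteq A$ with $1\le|X|\le s$, $w^2\big(\bigcup_{x\in X}C_x\big)\le w^2\big(\bigcup_{x\in X}N^+_x\big)$. *)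

theory Defs
  imports Complex_Main
begin

text \<open>Edges are two-element subsets of \<open>V\<close>, so adjacency is symmetric and irreflexive.\<close>

definition finite_simple_graph :: "'a set \<Rightarrow> 'a set set \<Rightarrow> bool" where
  "finite_simple_graph V E \<longleftrightarrow> finite V \<and> (\<forall>e\<in>E. e \<subseteq> V \<and> card e = 2)"

definition adjacent :: "'a set set \<Rightarrow> 'a \<Rightarrow> 'a \<Rightarrow> bool" where
  "adjacent E u v \<longleftrightarrow> {u, v} \<in> E"

definition independent_vertices :: "'a set \<Rightarrow> 'a set set \<Rightarrow> 'a set \<Rightarrow> bool" where
  "independent_vertices V E S \<longleftrightarrow> S \<subseteq> V \<and> (\<forall>u\<in>S. \<forall>v\<in>S. \<not> adjacent E u v)"

text \<open>The induced subgraph on \<open>insert c L\<close> below is a \<open>d\<close>-claw with centre \<open>c\<close> and talons \<open>L\<close>.\<close>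

definition claw_free :: "nat \<Rightarrow> 'a set \<Rightarrow> 'a set set \<Rightarrow> bool" where
  "claw_free d V E \<longleftrightarrow>
     \<not> (\<exists>c\<in>V. \<exists>L. independent_vertices V E L \<and> card L = d \<and> (\<forall>v\<in>L. adjacent E c v))"

definition weight :: "('a \<Rightarrow> real) \<Rightarrow> 'a set \<Rightarrow> real" where
  "weight w X = (\<Sum>v\<in>X. w v)"

definition sq_weight :: "('a \<Rightarrow> real) \<Rightarrow> 'a set \<Rightarrow> real" where
  "sq_weight w X = (\<Sum>v\<in>X. (w v)\<^sup>2)"

definition max_weight_independent ::
    "'a set \<Rightarrow> 'a set set \<Rightarrow> ('a \<Rightarrow> real) \<Rightarrow> 'a set \<Rightarrow> bool" where
  "max_weight_independent V E w S \<longleftrightarrow>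
     independent_vertices V E S \<and>
     (\<forall>T. independent_vertices V E T \<longrightarrow> weight w T \<le> weight w S)"

text \<open>Vertices common to \<open>X\<close> and \<open>Y\<close> count as neighbours.\<close>

definition nbhd :: "'a set set \<Rightarrow> 'a set \<Rightarrow> 'a set \<Rightarrow> 'a set" where
  "nbhd E X Y = {y \<in> Y. \<exists>x\<in>X. adjacent E x y} \<union> (X \<inter> Y)"

text \<open>
  \<open>p\<close> is the map usually written \<open>\<pi>\<close>. Ties are resolved by the choice of the function \<open>p\<close>,
  whose values outside \<open>S\<close> are irrelevant.
\<close>

definition max_weight_nbr ::
    "'a set set \<Rightarrow> ('a \<Rightarrow> real) \<Rightarrow> 'a set \<Rightarrow> 'a set \<Rightarrow> ('a \<Rightarrow> 'a) \<Rightarrow> bool" where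
  "max_weight_nbr E w S A p \<longleftrightarrow>
     (\<forall>v\<in>S. p v \<in> nbhd E {v} A \<and> (\<forall>a\<in>nbhd E {v} A. w a \<le> w (p v)))"

text \<open>The sets \<open>C\<^sub>a\<close> and \<open>N\<^sup>+\<^sub>a\<close>.\<close>

definition charged :: "'a set \<Rightarrow> ('a \<Rightarrow> 'a) \<Rightarrow> 'a \<Rightarrow> 'a set" where
  "charged S p a = {v \<in> S. p v = a}"

definition closed_nbhd ::
    "'a set set \<Rightarrow> 'a set \<Rightarrow> 'a set \<Rightarrow> ('a \<Rightarrow> 'a) \<Rightarrow> 'a \<Rightarrow> 'a set" where
  "closed_nbhd E S A p a = {a} \<union> (\<Union>v\<in>charged S p a. nbhd E {v} (A - {a}))"

definition locally_optimal ::
    "'a set set \<Rightarrow> ('a \<Rightarrow> real) \<Rightarrow> 'a set \<Rightarrow> 'a set \<Rightarrow> ('a \<Rightarrow> 'a) \<Rightarrow> nat \<Rightarrow> bool" where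
  "locally_optimal E w S A p s \<longleftrightarrow>
     (\<forall>X. X \<subseteq> A \<and> 1 \<le> card X \<and> card X \<le> s \<longrightarrow>
        sq_weight w (\<Union>x\<in>X. charged S p x) \<le> sq_weight w (\<Union>x\<in>X. closed_nbhd E S A p x))"

end

theory Submission
  imports Defs
begin

text \<open>
  For \<open>y \<in> A\<close> write \<open>C\<^sub>y\<close> for the vertices charged to \<open>y\<close>, \<open>P\<^sub>y = N\<^sup>+\<^sub>y - y\<close>, and let the slack
  \<open>\<sigma>\<^sub>y\<close> be the amount by which Berman's bound \<open>\<Sum>\<^bsub>o\<in>C\<^sub>y\<^esub> (2w\<^sub>o - w(N(o,A))) \<le> w\<^sub>y\<close> fails to be tight.
  Double counting gives \<open>2w(O) = (k+1)w(A) - \<Sum>\<^sub>y (\<sigma>\<^sub>y + m\<^sub>y)\<close>, where \<open>m\<^sub>y \<ge> 0\<close> accounts for the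
  neighbours in \<open>O\<close> that \<open>y\<close> lacks. So it suffices that slack plus \<open>m\<close> averages at least
  \<open>\<beta>w\<^sub>y\<close>, \<open>\<beta>\<close> being the minimum in the theorem.

  Exchanging \<open>y\<close> together with vertices of \<open>P\<^sub>y\<close> shows that \<open>\<sigma>\<^sub>y\<close> is at least the total deficit
  \<open>w\<^sub>b - \<sigma>\<^sub>b\<close> of the \<open>b \<in> P\<^sub>y\<close>. Hence \<open>y\<close> can afford to pay one third of each such deficit, after which
  every \<open>y\<close> with two incoming payments is satisfied (\<open>\<beta> \<le> 2/3\<close>). The remaining poor vertices have
  almost all of their \<open>O\<close>-neighbours in \<open>C\<^sub>y\<close>; with \<open>r = sqrt(1-\<epsilon>)\<close>, the inequality
  \<open>2w\<^sub>ow\<^sub>y \<le> w\<^sub>o\<^sup>2/r + r w\<^sub>y\<^sup>2\<close> shows that they lack at most about \<open>(1/r - 1)w\<^sub>b\<close> for each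
  \<open>b \<in> P\<^sub>y\<close> with \<open>w\<^sub>b > r w\<^sub>y\<close>. Exchanges along a chain \<open>y, b, P\<^sub>b\<close> show that such a \<open>b\<close> can spare
  this amount for one poor vertex. If several poor vertices compete for \<open>b\<close>, the one with the
  smallest gap \<open>w\<^sup>2(N\<^sup>+\<^sub>y) - w\<^sup>2(C\<^sub>y)\<close> receives it, and exchanging a losing \<open>y\<close> with \<open>P\<^sub>y\<close> and
  all winners shows that the losers do not need it.
\<close>

lemma sum_UN_le:
  fixes f :: "'b \<Rightarrow> real"
  assumes "finite I" "\<And>i. i \<in> I \<Longrightarrow> finite (X i)" "\<And>x. x \<in> (\<Union>i\<in>I. X i) \<Longrightarrow> 0 \<le> f x"
  shows "sum f (\<Union>i\<in>I. X i) \<le> (\<Sum>i\<in>I. sum f (X i))"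
  using assms
proof (induction I)
  case (insert i I)
  have "0 \<le> sum f (X i \<inter> (\<Union>j\<in>I. X j))" using insert.prems by (intro sum_nonneg) auto
  moreover have "sum f (\<Union>j\<in>I. X j) \<le> (\<Sum>j\<in>I. sum f (X j))"
    using insert.prems by (intro insert.IH) auto
  moreover have "sum f (\<Union>j\<in>insert i I. X j)
      = sum f (X i) + sum f (\<Union>j\<in>I. X j) - sum f (X i \<inter> (\<Union>j\<in>I. X j))"
    using insert.hyps insert.prems by (simp add: sum_Un)
  ultimately show ?case using insert.hyps by simp
qed simp

section \<open>Charges, payments and local optimality, abstracted from the graph\<close>

locale exchange_optimum =
  fixes A Opt :: "'a set" and nb :: "'a \<Rightarrow> 'a set" and p :: "'a \<Rightarrow> 'a"
    and w :: "'a \<Rightarrow> real" and k :: nat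
  assumes finite_A: "finite A" and finite_Opt: "finite Opt"
    and nb_subset: "\<And>v. v \<in> Opt \<Longrightarrow> nb v \<subseteq> A"
    and p_in_nb: "\<And>v. v \<in> Opt \<Longrightarrow> p v \<in> nb v"
    and p_max: "\<And>v b. v \<in> Opt \<Longrightarrow> b \<in> nb v \<Longrightarrow> w b \<le> w (p v)"
    and w_pos: "\<And>a. a \<in> A \<Longrightarrow> 0 < w a"
    and card_nb: "\<And>v. v \<in> Opt \<Longrightarrow> card (nb v) \<le> k"
    and card_conflicts: "\<And>a. a \<in> A \<Longrightarrow> card {v \<in> Opt. a \<in> nb v} \<le> k"
    and optimum: "\<And>Y. Y \<subseteq> A \<Longrightarrow> Y \<noteq> {} \<Longrightarrow> card Y \<le> 1 + 2 * k * (k - 1) \<Longrightarrow>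
      sq_weight w (\<Union>y\<in>Y. charged Opt p y)
      \<le> sq_weight w (\<Union>y\<in>Y. insert y ((\<Union>v\<in>charged Opt p y. nb v) - {y}))"
begin

definition P :: "'a \<Rightarrow> 'a set" where
  "P y = (\<Union>v\<in>charged Opt p y. nb v) - {y}"

definition u :: "'a \<Rightarrow> nat" where "u y = card (charged Opt p y)"

definition J :: "'a \<Rightarrow> nat" where "J y = card {v \<in> Opt. y \<in> nb v \<and> p v \<noteq> y}"

text \<open>Counts \<open>b\<close> once for every charged \<open>v\<close> with
  \<open>b \<in> nb v\<close>, which makes \<open>sum_pay\<close> an exact identity.\<close>

definition pay :: "'a \<Rightarrow> ('a \<Rightarrow> real) \<Rightarrow> real" where
  "pay y f = (\<Sum>v\<in>charged Opt p y. \<Sum>b\<in>nb v - {y}. f b)"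

definition gap :: "'a \<Rightarrow> real" where
  "gap y = (w y)\<^sup>2 + sq_weight w (P y) - sq_weight w (charged Opt p y)"

text \<open>Every \<open>v\<close> charged to \<open>y\<close> has \<open>y \<in> nb v\<close>, so
  the weights of these neighbourhoods add up to \<open>u y * w y + pay y w\<close>.\<close>

definition slack :: "'a \<Rightarrow> real" where
  "slack y = (1 + real (u y)) * w y + pay y w - 2 * weight w (charged Opt p y)"

definition deficit :: "'a \<Rightarrow> real" where "deficit y = max 0 (w y - slack y)"

text \<open>Exchanging \<open>y\<close> with the deficient vertices of \<open>P y\<close> shows that
  the gap covers their deficits; this is what remains.\<close>

definition reserve :: "'a \<Rightarrow> real" where
  "reserve y = gap y - (\<Sum>b\<in>P y. w b * deficit b)"

definition balance :: "'a \<Rightarrow> real" where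
  "balance y = slack y - pay y deficit / 3 + real (J y) * deficit y / 3"

lemma finite_charged [simp]: "finite (charged Opt p y)"
  using finite_Opt by (simp add: charged_def)

lemma charged_subset: "charged Opt p y \<subseteq> Opt"
  by (auto simp: charged_def)

lemma P_subset: "P y \<subseteq> A"
  using nb_subset charged_subset by (fastforce simp: P_def)

lemma finite_P [simp]: "finite (P y)"
  using finite_subset[OF P_subset finite_A] .

lemma finite_nb: "v \<in> Opt \<Longrightarrow> finite (nb v)"
  using nb_subset finite_A finite_subset by blast

lemma self_notin_P [simp]: "y \<notin> P y"
  by (simp add: P_def)

lemma P_weight_le: "b \<in> P y \<Longrightarrow> w b \<le> w y"
  using p_max by (auto simp: P_def charged_def)

lemma P_weight_pos: "b \<in> P y \<Longrightarrow> 0 < w b"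
  using P_subset w_pos by blast

lemma card_charged: assumes "y \<in> A" shows "u y + J y = card {v \<in> Opt. y \<in> nb v}"
proof -
  have "{v \<in> Opt. y \<in> nb v} = charged Opt p y \<union> {v \<in> Opt. y \<in> nb v \<and> p v \<noteq> y}"
    using p_in_nb by (auto simp: charged_def)
  moreover have "charged Opt p y \<inter> {v \<in> Opt. y \<in> nb v \<and> p v \<noteq> y} = {}"
    by (auto simp: charged_def)
  ultimately show ?thesis
    using finite_Opt by (simp add: u_def J_def card_Un_disjoint)
qed

lemma u_J_le: "y \<in> A \<Longrightarrow> u y + J y \<le> k"
  using card_charged card_conflicts by simp

lemma card_P: assumes "y \<in> A" shows "card (P y) \<le> k * (k - 1)"
proof -
  have "card (P y) = card (\<Union>v\<in>charged Opt p y. nb v - {y})"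
    by (rule arg_cong[where f = card]) (auto simp: P_def)
  also have "\<dots> \<le> (\<Sum>v\<in>charged Opt p y. card (nb v - {y}))"
    by (rule card_UN_le) simp
  also have "\<dots> \<le> (\<Sum>v\<in>charged Opt p y. k - 1)"
  proof (rule sum_mono)
    fix v assume v: "v \<in> charged Opt p y"
    then have "v \<in> Opt" "y \<in> nb v" using p_in_nb by (auto simp: charged_def)
    then show "card (nb v - {y}) \<le> k - 1"
      using card_nb[of v] finite_nb by (simp add: diff_le_mono)
  qed
  also have "\<dots> \<le> k * (k - 1)"
    using u_J_le[OF assms] by (simp add: u_def)
  finally show ?thesis .
qed

lemma J_pos: assumes "b \<in> P y" shows "1 \<le> J b"
proof -
  obtain v where "v \<in> Opt" "p v = y" "b \<in> nb v" "b \<noteq> y"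
    using assms by (auto simp: P_def charged_def)
  then have "{v \<in> Opt. b \<in> nb v \<and> p v \<noteq> b} \<noteq> {}" by auto
  then have "0 < J b" using finite_Opt by (simp add: J_def card_gt_0_iff)
  then show ?thesis by simp
qed

lemma pay_linear:
  "pay y (\<lambda>b. f b - g b) = pay y f - pay y g"
  "pay y (\<lambda>b. c * f b) = c * pay y f"
  by (simp_all add: pay_def sum_subtractf sum_distrib_left)

lemma pay_ge:
  assumes "\<And>b. b \<in> P y \<Longrightarrow> 0 \<le> f b"
  shows "(\<Sum>b\<in>P y. f b) \<le> pay y f"
proof -
  have P: "P y = (\<Union>v\<in>charged Opt p y. nb v - {y})"
    by (auto simp: P_def)
  have "(\<Sum>b\<in>(\<Union>v\<in>charged Opt p y. nb v - {y}). f b)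
      \<le> (\<Sum>v\<in>charged Opt p y. \<Sum>b\<in>nb v - {y}. f b)"
  proof (rule sum_UN_le)
    fix x assume "x \<in> (\<Union>v\<in>charged Opt p y. nb v - {y})"
    then show "0 \<le> f x" using assms unfolding P by blast
  next
    fix v assume "v \<in> charged Opt p y"
    then show "finite (nb v - {y})" using finite_nb charged_subset by blast
  qed simp
  then show ?thesis unfolding pay_def P .
qed

text \<open>The pairs \<open>(v, b)\<close> with \<open>b \<in> nb v\<close> and
  \<open>b \<noteq> p v\<close>, grouped by \<open>p v\<close> on the left and by \<open>b\<close>
  on the right.\<close>

lemma sum_pay: "(\<Sum>y\<in>A. pay y f) = (\<Sum>b\<in>A. real (J b) * f b)"
proof -
  have img: "p ` Opt \<subseteq> A" using p_in_nb nb_subset by blast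
  have "(\<Sum>y\<in>A. pay y f) = (\<Sum>y\<in>A. \<Sum>v\<in>{v \<in> Opt. p v = y}. \<Sum>b\<in>nb v - {p v}. f b)"
    by (intro sum.cong) (auto simp: pay_def charged_def)
  also have "\<dots> = (\<Sum>v\<in>Opt. \<Sum>b\<in>nb v - {p v}. f b)"
    by (rule sum.group[OF finite_Opt finite_A img])
  also have "\<dots> = (\<Sum>v\<in>Opt. \<Sum>b\<in>A. if b \<in> nb v \<and> p v \<noteq> b then f b else 0)"
  proof (rule sum.cong)
    fix v assume "v \<in> Opt"
    then have "nb v - {p v} = {b \<in> A. b \<in> nb v \<and> p v \<noteq> b}" using nb_subset by auto
    then show "(\<Sum>b\<in>nb v - {p v}. f b) = (\<Sum>b\<in>A. if b \<in> nb v \<and> p v \<noteq> b then f b else 0)"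
      by (simp add: sum.inter_filter finite_A)
  qed simp
  also have "\<dots> = (\<Sum>b\<in>A. \<Sum>v\<in>Opt. if b \<in> nb v \<and> p v \<noteq> b then f b else 0)"
    by (rule sum.swap)
  also have "\<dots> = (\<Sum>b\<in>A. real (J b) * f b)"
    by (intro sum.cong) (auto simp: J_def sum.inter_filter[symmetric] finite_Opt)
  finally show ?thesis .
qed

lemma sum_charged: "(\<Sum>y\<in>A. \<Sum>v\<in>charged Opt p y. f v) = (\<Sum>v\<in>Opt. (f v :: real))"
proof -
  have img: "p ` Opt \<subseteq> A" using p_in_nb nb_subset by blast
  show ?thesis unfolding charged_def by (rule sum.group[OF finite_Opt finite_A img])
qed

text \<open>By \<open>sum_pay\<close> the coefficient of \<open>w y\<close> in the total slack is
  \<open>1 + u y + J y\<close>; the second summand fills it up to \<open>k + 1\<close>.\<close>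

lemma sum_slack:
  "(\<Sum>y\<in>A. slack y + (real k - real (u y) - real (J y)) * w y)
    = (real k + 1) * weight w A - 2 * weight w Opt"
proof -
  have "(\<Sum>y\<in>A. slack y) = (\<Sum>y\<in>A. (1 + real (u y) + real (J y)) * w y) - 2 * weight w Opt"
  proof -
    have "(\<Sum>y\<in>A. slack y) = (\<Sum>y\<in>A. (1 + real (u y)) * w y) + (\<Sum>y\<in>A. pay y w)
        - 2 * (\<Sum>y\<in>A. \<Sum>v\<in>charged Opt p y. w v)"
      by (simp add: slack_def weight_def sum.distrib sum_subtractf sum_distrib_left)
    then show ?thesis
      unfolding sum_pay sum_charged
      by (simp add: weight_def sum.distrib[symmetric] algebra_simps)
  qed
  then show ?thesis
    by (simp add: sum.distrib weight_def sum_distrib_left algebra_simps sum_subtractf)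
qed

lemma sum_balance: "(\<Sum>y\<in>A. balance y) = (\<Sum>y\<in>A. slack y)"
  unfolding balance_def sum.distrib sum_subtractf sum_divide_distrib[symmetric]
  by (simp add: sum_pay)

section \<open>Exchange inequalities\<close>

lemma sq_weight_mono: "finite Y \<Longrightarrow> X \<subseteq> Y \<Longrightarrow> sq_weight w X \<le> sq_weight w Y"
  by (auto simp: sq_weight_def intro: sum_mono2)

lemma sq_weight_nonneg [simp]: "0 \<le> sq_weight w X"
  by (simp add: sq_weight_def sum_nonneg)

lemma sq_weight_Un_le: "finite X \<Longrightarrow> finite Y \<Longrightarrow> sq_weight w (X \<union> Y) \<le> sq_weight w X + sq_weight w Y"
  by (simp add: sq_weight_def sum_Un sum_nonneg)

lemma sq_weight_split: "finite X \<Longrightarrow> sq_weight w X = sq_weight w (X \<inter> Y) + sq_weight w (X - Y)"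
  by (metis sq_weight_def sum.Int_Diff)

text \<open>Adding up the squared weights of all \<open>P z\<close> and of \<open>Y\<close>
  overcounts their union. The left side retains the overcount from \<open>P y\<close> meeting
  \<open>Y\<close> and from the other \<open>P z\<close> meeting \<open>P y\<close> or
  \<open>Y\<close>.\<close>

lemma exchange:
  assumes Y: "Y \<subseteq> A" "card Y \<le> 1 + 2 * k * (k - 1)" and y: "y \<in> Y"
  shows "sq_weight w (P y \<inter> Y) + sq_weight w ((\<Union>z\<in>Y - {y}. P z) \<inter> (P y \<union> Y)) \<le> sum gap Y"
proof -
  define U where "U = (\<Union>z\<in>Y - {y}. P z)"
  have "finite Y" using Y finite_A finite_subset by blast
  then have fin: "finite Y" "finite U" by (auto simp: U_def)
  have "(\<Sum>z\<in>Y. sq_weight w (charged Opt p z)) = sq_weight w (\<Union>z\<in>Y. charged Opt p z)"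
    unfolding sq_weight_def
    by (rule sum.UNION_disjoint[symmetric]) (use fin in \<open>auto simp: charged_def finite_Opt\<close>)
  also have "\<dots> \<le> sq_weight w (\<Union>z\<in>Y. insert z (P z))"
    using optimum[of Y] Y y by (auto simp: P_def)
  \<comment> \<open>Each vertex is assigned to the first of \<open>Y\<close>, \<open>P y\<close>,
    \<open>U\<close> that contains it.\<close>
  also have "(\<Union>z\<in>Y. insert z (P z)) = Y \<union> ((P y - Y) \<union> (U - (P y \<union> Y)))"
    using y by (auto simp: U_def)
  also have "sq_weight w \<dots> \<le> sq_weight w Y + (sq_weight w (P y - Y) + sq_weight w (U - (P y \<union> Y)))"
    using fin by (intro order_trans[OF sq_weight_Un_le] add_left_mono) auto
  finally have 1: "(\<Sum>z\<in>Y. sq_weight w (charged Opt p z))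
      \<le> sq_weight w Y + (sq_weight w (P y - Y) + sq_weight w (U - (P y \<union> Y)))" .
  have "sq_weight w U \<le> (\<Sum>z\<in>Y - {y}. sq_weight w (P z))"
    unfolding U_def sq_weight_def by (rule sum_UN_le) (use fin in auto)
  then have 2: "sq_weight w (P y) + sq_weight w U \<le> (\<Sum>z\<in>Y. sq_weight w (P z))"
    using y fin by (simp add: sum.remove[of Y y])
  have "sum gap Y = sq_weight w Y + (\<Sum>z\<in>Y. sq_weight w (P z)) - (\<Sum>z\<in>Y. sq_weight w (charged Opt p z))"
    by (simp add: gap_def sum.distrib sum_subtractf sq_weight_def)
  with 1 2 show ?thesis
    using sq_weight_split[of "P y" Y] sq_weight_split[OF fin(2), of "P y \<union> Y"]
    by (simp add: U_def[symmetric])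
qed

lemma gap_nonneg: "y \<in> A \<Longrightarrow> 0 \<le> gap y"
  using exchange[of "{y}" y] by (simp add: sq_weight_def)

text \<open>Sum \<open>2 * w v * w y \<le> (w v)^2 / q + q * (w y)^2\<close> over the charged
  \<open>v\<close> and express their squared weight through the gap.\<close>

lemma slack_ge:
  assumes q: "0 < q"
  shows "w y * slack y \<ge> (1 - 1 / q + real (u y) * (1 - q)) * (w y)\<^sup>2 + gap y / q
    + w y * pay y w - sq_weight w (P y) / q"
proof -
  have "2 * w y * weight w (charged Opt p y)
      \<le> sq_weight w (charged Opt p y) / q + q * real (u y) * (w y)\<^sup>2"
  proof -
    have "2 * w y * w v \<le> (w v)\<^sup>2 / q + q * (w y)\<^sup>2" for v
    proof -
      have "0 \<le> (w v - q * w y)\<^sup>2 / q" using q by simp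
      then show ?thesis using q by (simp add: power2_diff field_simps power2_eq_square)
    qed
    then have "(\<Sum>v\<in>charged Opt p y. 2 * w y * w v)
        \<le> (\<Sum>v\<in>charged Opt p y. (w v)\<^sup>2 / q + q * (w y)\<^sup>2)"
      by (intro sum_mono)
    then show ?thesis
      by (simp add: weight_def sq_weight_def u_def sum.distrib sum_distrib_left
          sum_divide_distrib mult_ac)
  qed
  moreover have "sq_weight w (charged Opt p y) / q = (w y)\<^sup>2 / q + sq_weight w (P y) / q - gap y / q"
    by (simp add: gap_def add_divide_distrib diff_divide_distrib)
  ultimately show ?thesis
    by (simp add: slack_def algebra_simps power2_eq_square)
qed

text \<open>The case \<open>q = 1\<close>: no vertex of \<open>P y\<close> outweighs
  \<open>y\<close>, so its squared weight is at most \<open>w y * pay y w\<close>.\<close>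

lemma gap_le: assumes "y \<in> A" shows "gap y \<le> w y * slack y"
proof -
  have "sq_weight w (P y) \<le> (\<Sum>b\<in>P y. w y * w b)"
    unfolding sq_weight_def power2_eq_square
    using P_weight_le P_weight_pos by (intro sum_mono mult_right_mono) (auto simp: less_imp_le)
  also have "\<dots> \<le> w y * pay y w"
    using pay_ge[of y w] P_weight_pos w_pos[OF assms]
    by (simp add: sum_distrib_left[symmetric] less_imp_le)
  finally show ?thesis using slack_ge[of 1 y] by simp
qed

lemma slack_nonneg: "y \<in> A \<Longrightarrow> 0 \<le> slack y"
  using gap_le gap_nonneg w_pos by (metis order_trans zero_le_mult_iff not_less)

lemma deficit_bounds: "0 \<le> deficit y" "y \<in> A \<Longrightarrow> deficit y \<le> w y" "w y - slack y \<le> deficit y"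
  using slack_nonneg[of y] w_pos[of y] by (auto simp: deficit_def)

lemma deficit_gap: "b \<in> A \<Longrightarrow> 0 < deficit b \<Longrightarrow> w b * deficit b \<le> (w b)\<^sup>2 - gap b"
  using gap_le[of b] by (auto simp: deficit_def max_def power2_eq_square algebra_simps split: if_splits)

text \<open>\<open>deficit_gap\<close> applies to positive deficits only; the others contribute
  nothing on the left.\<close>

lemma sum_deficit_le:
  assumes "finite X" "X \<subseteq> A"
  shows "(\<Sum>b\<in>X. w b * deficit b) \<le> sq_weight w {b \<in> X. 0 < deficit b} - sum gap {b \<in> X. 0 < deficit b}"
proof -
  have "(\<Sum>b\<in>X. w b * deficit b) = (\<Sum>b\<in>{b \<in> X. 0 < deficit b}. w b * deficit b)"
    using assms deficit_bounds(1) by (intro sum.mono_neutral_right) (auto simp: less_le)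
  also have "\<dots> \<le> (\<Sum>b\<in>{b \<in> X. 0 < deficit b}. (w b)\<^sup>2 - gap b)"
    using assms by (intro sum_mono deficit_gap) auto
  finally show ?thesis by (simp add: sq_weight_def sum_subtractf)
qed

lemma sum_gap_Un_le:
  assumes "X \<subseteq> A" "Y \<subseteq> A" shows "sum gap (X \<union> Y) \<le> sum gap X + sum gap Y"
proof -
  have fin: "finite X" "finite Y" using assms finite_A finite_subset by auto
  have "0 \<le> sum gap (X \<inter> Y)" using assms gap_nonneg by (intro sum_nonneg) auto
  then show ?thesis using fin by (simp add: sum_Un)
qed

text \<open>Exchange \<open>y\<close>, the deficient vertices of \<open>P y\<close> and the
  competitors \<open>l b\<close>. The deficient vertices are overcounted through \<open>Y\<close>
  and \<open>P y\<close>, those of \<open>B\<close> through \<open>P y\<close> and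
  \<open>P (l b)\<close>.\<close>

lemma reserve_ge:
  assumes y: "y \<in> A" and B: "B \<subseteq> P y"
    and l: "\<And>b. b \<in> B \<Longrightarrow> l b \<in> A \<and> l b \<noteq> y \<and> b \<in> P (l b)"
  shows "(\<Sum>b\<in>B. (w b)\<^sup>2 - gap (l b)) \<le> reserve y"
proof -
  define D where "D = {b \<in> P y. 0 < deficit b}"
  define Y where "Y = {y} \<union> (D \<union> l ` B)"
  have finB: "finite B" using B finite_subset finite_P by blast
  have D: "D \<subseteq> P y" "finite D" by (auto simp: D_def)
  have lB: "l ` B \<subseteq> A" using l by auto
  have sub: "D \<subseteq> A" "Y \<subseteq> A" using D P_subset y lB by (auto simp: Y_def)
  \<comment> \<open>Besides \<open>y\<close> there are two sets of at most \<open>card (P y)\<close>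
    vertices each, whence the exchange size \<open>1 + 2 * k * (k - 1)\<close>.\<close>
  have "card Y \<le> 1 + (card (P y) + card (P y))"
  proof -
    have "card Y \<le> card {y} + card (D \<union> l ` B)" unfolding Y_def by (rule card_Un_le)
    also have "card (D \<union> l ` B) \<le> card D + card (l ` B)" by (rule card_Un_le)
    also have "card D \<le> card (P y)" using D by (intro card_mono) auto
    also have "card (l ` B) \<le> card B" using finB by (rule card_image_le)
    also have "card B \<le> card (P y)" using B by (intro card_mono) auto
    finally show ?thesis by simp
  qed
  then have cY: "card Y \<le> 1 + 2 * k * (k - 1)" using card_P[OF y] by simp
  have "sq_weight w D + sq_weight w B
      \<le> sq_weight w (P y \<inter> Y) + sq_weight w ((\<Union>z\<in>Y - {y}. P z) \<inter> (P y \<union> Y))"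
  proof (intro add_mono sq_weight_mono)
    show "B \<subseteq> (\<Union>z\<in>Y - {y}. P z) \<inter> (P y \<union> Y)" using B l by (auto simp: Y_def)
    show "finite ((\<Union>z\<in>Y - {y}. P z) \<inter> (P y \<union> Y))"
      using sub finite_A finite_subset by (metis finite_Int finite_P finite_Un)
  qed (use D in \<open>auto simp: Y_def\<close>)
  also have "\<dots> \<le> sum gap Y" by (rule exchange) (use sub cY in \<open>auto simp: Y_def\<close>)
  also have "\<dots> \<le> gap y + (sum gap D + sum gap (l ` B))"
    unfolding Y_def using sum_gap_Un_le[of "{y}" "D \<union> l ` B"] sum_gap_Un_le[of D "l ` B"] y sub lB
    by simp
  \<comment> \<open>Several \<open>b\<close> may share a competitor; gaps being nonnegative,
    counting it repeatedly only enlarges the sum.\<close>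
  also have "sum gap (l ` B) \<le> (\<Sum>b\<in>B. gap (l b))"
    using sum_image_le[of B gap l] finB lB gap_nonneg by (auto simp: o_def)
  finally show ?thesis
    using sum_deficit_le[of "P y"] P_subset
    by (simp add: reserve_def D_def[symmetric] sum_subtractf sq_weight_def)
qed

lemma reserve_nonneg: "y \<in> A \<Longrightarrow> 0 \<le> reserve y"
  using reserve_ge[of y "{}" id] by simp

text \<open>Exchange \<open>y\<close>, \<open>b\<close> and the deficient vertices of
  \<open>P y\<close> and \<open>P b\<close>. This bounds \<open>reserve b\<close> from below in
  terms of \<open>reserve y\<close>.\<close>

lemma chain_exchange:
  assumes y: "y \<in> A" and b: "b \<in> P y"
  shows "(w b)\<^sup>2 + (\<Sum>c\<in>P b. w c * deficit c) \<le> reserve y + w b * deficit b + gap b"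
proof -
  \<comment> \<open>\<open>b\<close> takes part even if its deficit is zero, so it is kept apart
    from \<open>D\<close>.\<close>
  define D where "D = {b' \<in> P y - {b}. 0 < deficit b'}"
  define D' where "D' = {c \<in> P b. 0 < deficit c}"
  define Y where "Y = {y} \<union> (insert b D \<union> D')"
  have bA: "b \<in> A" using b P_subset[of y] by blast
  have D: "D \<subseteq> P y" "finite D" "b \<notin> D" "D' \<subseteq> P b" "finite D'" by (auto simp: D_def D'_def)
  have sub: "insert b D \<subseteq> A" "D' \<subseteq> A" "Y \<subseteq> A" using D P_subset[of y] P_subset[of b] y bA by (auto simp: Y_def)
  have "card Y \<le> 1 + (card (P y) + card (P b))"
  proof -
    have "card Y \<le> card {y} + card (insert b D \<union> D')" unfolding Y_def by (rule card_Un_le)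
    also have "card (insert b D \<union> D') \<le> card (insert b D) + card D'" by (rule card_Un_le)
    also have "card (insert b D) \<le> card (P y)" using D b by (intro card_mono) auto
    also have "card D' \<le> card (P b)" using D by (intro card_mono) auto
    finally show ?thesis by simp
  qed
  then have cY: "card Y \<le> 1 + 2 * k * (k - 1)" using card_P[OF y] card_P[OF bA] by simp
  have "sq_weight w (insert b D) + sq_weight w D'
      \<le> sq_weight w (P y \<inter> Y) + sq_weight w ((\<Union>z\<in>Y - {y}. P z) \<inter> (P y \<union> Y))"
  proof (intro add_mono sq_weight_mono)
    have "b \<noteq> y" using b by auto
    then show "D' \<subseteq> (\<Union>z\<in>Y - {y}. P z) \<inter> (P y \<union> Y)" using D by (auto simp: Y_def)
    show "finite ((\<Union>z\<in>Y - {y}. P z) \<inter> (P y \<union> Y))"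
      using sub finite_A finite_subset by (metis finite_Int finite_P finite_Un)
  qed (use D b in \<open>auto simp: Y_def\<close>)
  also have "\<dots> \<le> sum gap Y" by (rule exchange) (use sub cY in \<open>auto simp: Y_def\<close>)
  also have "\<dots> \<le> gap y + (sum gap (insert b D) + sum gap D')"
    unfolding Y_def
    using sum_gap_Un_le[of "{y}" "insert b D \<union> D'"] sum_gap_Un_le[of "insert b D" D'] y sub
    by simp
  finally have "sq_weight w D + (w b)\<^sup>2 + sq_weight w D' \<le> gap y + gap b + sum gap D + sum gap D'"
    using D by (simp add: sq_weight_def)
  moreover have "(\<Sum>b'\<in>P y. w b' * deficit b') = w b * deficit b + (\<Sum>b'\<in>P y - {b}. w b' * deficit b')"
    using b by (simp add: sum.remove)
  ultimately show ?thesis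
    using sum_deficit_le[of "P y - {b}", folded D_def] sum_deficit_le[of "P b", folded D'_def]
      P_subset[of y] P_subset[of b] unfolding reserve_def by fastforce
qed

section \<open>Slack net of payments\<close>

lemma reserve_le_slack:
  assumes y: "y \<in> A"
  shows "reserve y + w y * pay y deficit \<le> w y * slack y"
proof -
  \<comment> \<open>One factor \<open>w b\<close> is raised to \<open>w y\<close>; the other factor
    \<open>w b - deficit b\<close> is nonnegative.\<close>
  have "(\<Sum>b\<in>P y. (w b)\<^sup>2 - w b * deficit b) \<le> (\<Sum>b\<in>P y. w y * (w b - deficit b))"
  proof (rule sum_mono)
    fix b assume b: "b \<in> P y"
    then have "b \<in> A" using P_subset by blast
    then have "w b * (w b - deficit b) \<le> w y * (w b - deficit b)"
      using P_weight_le[OF b] deficit_bounds(2)[of b] by (intro mult_right_mono) auto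
    then show "(w b)\<^sup>2 - w b * deficit b \<le> w y * (w b - deficit b)"
      by (simp add: power2_eq_square right_diff_distrib)
  qed
  also have "\<dots> \<le> w y * pay y (\<lambda>b. w b - deficit b)"
    unfolding sum_distrib_left[symmetric]
  proof (rule mult_left_mono[OF pay_ge])
    show "0 \<le> w b - deficit b" if "b \<in> P y" for b
      using deficit_bounds(2)[of b] P_subset[of y] that by auto
  qed (use w_pos[OF y] in simp)
  finally show ?thesis
    using slack_ge[of 1 y]
    by (simp add: pay_linear reserve_def sum_subtractf sq_weight_def right_diff_distrib)
qed

lemma pay_deficit_le: assumes "y \<in> A" shows "pay y deficit \<le> slack y"
proof -
  have "w y * pay y deficit \<le> w y * slack y"
    using reserve_le_slack[OF assms] reserve_nonneg[OF assms] by linarith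
  then show ?thesis using w_pos[OF assms] by simp
qed

lemma pay_weight_deficit_ge:
  assumes "0 \<le> c" "c \<le> 1"
  shows "(\<Sum>b\<in>P y. w b - c * deficit b) \<le> pay y w - c * pay y deficit"
proof -
  have "(\<Sum>b\<in>P y. w b - c * deficit b) \<le> pay y (\<lambda>b. w b - c * deficit b)"
  proof (rule pay_ge)
    fix b assume "b \<in> P y"
    then have "b \<in> A" using P_subset by blast
    then have "deficit b \<le> w b" "0 \<le> deficit b" using deficit_bounds by auto
    then have "c * deficit b \<le> 1 * w b" using assms by (intro mult_mono) auto
    then show "0 \<le> w b - c * deficit b" by simp
  qed
  then show ?thesis by (simp add: pay_linear)
qed

text \<open>\<open>slack_ge\<close> with \<open>q = 1\<close> and the gap split into reserve and
  deficits. The rate \<open>c\<close> will be \<open>1 / 3\<close>, or \<open>1 / 2\<close> for poor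
  vertices with \<open>J y = 1\<close>.\<close>

lemma net_slack_ge:
  assumes y: "y \<in> A" and c: "0 \<le> c" "c \<le> 1"
  shows "reserve y + (\<Sum>b\<in>P y. w b * deficit b + w b * (w y - w b) - c * w y * deficit b)
    \<le> w y * (slack y - c * pay y deficit)"
proof -
  have "w y * (\<Sum>b\<in>P y. w b - c * deficit b) \<le> w y * (pay y w - c * pay y deficit)"
    using w_pos[OF y] pay_weight_deficit_ge[OF c] by (intro mult_left_mono) auto
  then show ?thesis
    using slack_ge[of 1 y]
    by (simp add: reserve_def sum_subtractf sum.distrib sq_weight_def right_diff_distrib
        sum_distrib_left power2_eq_square mult_ac)
qed

lemma net_slack_ge_scaled:
  assumes y: "y \<in> A" and q: "0 < q" and c: "0 \<le> c" "c \<le> 1"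
  shows "(1 - 1 / q + real (u y) * (1 - q)) * w y + reserve y / (q * w y)
      + (\<Sum>b\<in>P y. w b - (w b)\<^sup>2 / (q * w y) + deficit b * (w b / (q * w y) - c))
    \<le> slack y - c * pay y deficit"
proof -
  have w: "0 < w y" using w_pos[OF y] .
  have "(1 - 1 / q + real (u y) * (1 - q)) * w y + gap y / (q * w y)
      + pay y w - sq_weight w (P y) / (q * w y)
    = ((1 - 1 / q + real (u y) * (1 - q)) * (w y)\<^sup>2 + gap y / q
      + w y * pay y w - sq_weight w (P y) / q) / w y"
    using w by (simp add: add_divide_distrib diff_divide_distrib power2_eq_square)
  also have "\<dots> \<le> w y * slack y / w y"
    using w slack_ge[OF q, of y] by (intro divide_right_mono) auto
  also have "\<dots> = slack y" using w by simp
  finally have "(1 - 1 / q + real (u y) * (1 - q)) * w y + gap y / (q * w y)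
      + pay y w - sq_weight w (P y) / (q * w y) \<le> slack y" .
  moreover have "gap y / (q * w y) = reserve y / (q * w y) + (\<Sum>b\<in>P y. deficit b * (w b / (q * w y)))"
    by (simp add: reserve_def diff_divide_distrib sum_divide_distrib mult_ac)
  ultimately show ?thesis
    using pay_weight_deficit_ge[OF c, of y]
    by (simp add: sum.distrib sum_subtractf right_diff_distrib sum_divide_distrib sq_weight_def
        mult_ac)
qed

lemma chain_pay_deficit_le:
  assumes y: "y \<in> A" and b: "b \<in> P y"
  shows "pay b deficit \<le> slack b - w b + deficit b + reserve y / w b"
proof -
  have bA: "b \<in> A" using b P_subset[of y] by blast
  have w: "0 < w b" using w_pos[OF bA] .
  have "(w b)\<^sup>2 - w b * deficit b - reserve y \<le> reserve b"
    using chain_exchange[OF y b] by (simp add: reserve_def)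
  then have "w b * pay b deficit \<le> w b * slack b - (w b)\<^sup>2 + w b * deficit b + reserve y"
    using reserve_le_slack[OF bA] by simp
  also have "\<dots> = w b * (slack b - w b + deficit b + reserve y / w b)"
    using w by (simp add: power2_eq_square algebra_simps)
  finally show ?thesis using w by simp
qed

text \<open>Lying in \<open>P y\<close> guarantees \<open>b\<close> one incoming payment, while the
  chain exchange limits what it pays. The result measures what \<open>b\<close> can give
  away.\<close>

lemma balance_chain:
  assumes y: "y \<in> A" and b: "b \<in> P y"
  shows "w b - 2 / 3 * deficit b - reserve y / (3 * w b) \<le> balance b"
proof -
  define q where "q = reserve y / w b"
  have "1 * deficit b \<le> real (J b) * deficit b"
    using J_pos[OF b] deficit_bounds(1)[of b] by (intro mult_right_mono) auto
  moreover have "pay b deficit \<le> slack b - w b + deficit b + q"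
    using chain_pay_deficit_le[OF y b] by (simp add: q_def)
  moreover have "reserve y / (3 * w b) = q / 3" by (simp add: q_def)
  ultimately show ?thesis
    using deficit_bounds(3)[of b] unfolding balance_def by argo
qed

end

section \<open>Poor vertices and discharging\<close>

locale discharging = exchange_optimum +
  fixes r \<beta> :: real
  assumes r_sq: "1 / 2 \<le> r\<^sup>2" and r_pos: "0 < r" and r_le: "r \<le> 1"
    and \<beta>_le_r: "\<beta> * (2 + r\<^sup>2) \<le> 2 * r\<^sup>2"
    and \<beta>_le_k: "\<beta> \<le> 1 - 1 / r + real k * (1 - r)"
begin

definition missing :: "'a \<Rightarrow> real" where
  "missing y = (real k - real (u y) - real (J y)) * w y"

definition poor :: "'a set" where
  "poor = {y \<in> A. balance y + missing y < \<beta> * w y}"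

text \<open>The \<open>b\<close> for which \<open>w b - (w b)^2 / (r * w y)\<close>, its term in
  \<open>net_slack_ge_scaled\<close> at \<open>q = r\<close> without the deficit part, is
  negative.\<close>

definition heavy :: "'a \<Rightarrow> 'a set" where "heavy y = {b \<in> P y. r * w y < w b}"

text \<open>
  The amount that \<open>b\<close> returns to the poor vertex \<open>y\<close>: exactly the negative contribution of \<open>b\<close> in
  \<open>net_slack_ge_scaled\<close> with \<open>q = r\<close>, \<open>c = 1/3\<close>, plus a bonus \<open>w b / 25\<close> that is needed only for poor
  vertices with \<open>J y = 1\<close>. The transfer may be negative.
\<close>

definition transfer :: "'a \<Rightarrow> 'a \<Rightarrow> real" where
  "transfer y b = (w b)\<^sup>2 / (r * w y) - w b - deficit b * (w b / (r * w y) - 1 / 3) + w b / 25"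

text \<open>A rational substitute for the bound \<open>1 / sqrt 2\<close>.\<close>

lemma r_gt: "7 / 10 < r"
proof (rule ccontr)
  assume "\<not> 7 / 10 < r"
  then have "r\<^sup>2 \<le> (7 / 10)\<^sup>2" using r_pos by (intro power_mono) auto
  then show False using r_sq by (simp add: power2_eq_square)
qed

lemma \<beta>_le: assumes "2 * r\<^sup>2 \<le> c * (2 + r\<^sup>2)" shows "\<beta> \<le> c"
proof -
  have "\<beta> * (2 + r\<^sup>2) \<le> c * (2 + r\<^sup>2)" using \<beta>_le_r assms by linarith
  moreover have "0 < 2 + r\<^sup>2" by (simp add: add_pos_nonneg)
  ultimately show ?thesis by (rule mult_right_le_imp_le)
qed

text \<open>In order: two incoming payments suffice; the gap bound for poor vertices; three bounds
  for the case \<open>J y = 1\<close>; the extreme case of \<open>heavy_weight_bound\<close>.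
  Through \<open>\<beta>_le\<close> each becomes a polynomial inequality in
  \<open>r\<close>.\<close>

lemma \<beta>_bounds:
  "\<beta> \<le> 2 / 3" "3 * \<beta> \<le> 2 * r" "3 * \<beta> \<le> 1 + r" "\<beta> \<le> 2 * r - 1"
  "\<beta> \<le> r - 1 / 3 + r / 25" "4 / 3 * \<beta> \<le> 2 - 1 / r - 1 / 25"
proof -
  have r2: "r\<^sup>2 \<le> 1" using r_pos r_le by (simp add: power_le_one)
  show "\<beta> \<le> 2 / 3" by (rule \<beta>_le) (use r2 in simp)
  have "0 \<le> r * ((1 - r) * (2 - r))" using r_pos r_le by simp
  then have "\<beta> \<le> 2 * r / 3"
    by (intro \<beta>_le) (simp add: power2_eq_square algebra_simps)
  then show "3 * \<beta> \<le> 2 * r" by simp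
  have "0 \<le> (1 - r) * (2 + 4 * r - r\<^sup>2)" using r_pos r_le r2 by (intro mult_nonneg_nonneg) auto
  then have "\<beta> \<le> (1 + r) / 3"
    by (intro \<beta>_le) (simp add: power2_eq_square algebra_simps)
  then show "3 * \<beta> \<le> 1 + r" by simp
  \<comment> \<open>The polynomials below are tight near \<open>r = 7/10\<close>, just outside the admissible range \<open>1/2 \<le> r\<^sup>2\<close>.\<close>
  have r7: "0 \<le> (r - 7 / 10) * (1 - r)" using r_gt r_le by simp
  have "r * 1 \<le> r * (2 * r\<^sup>2)" using r_sq r_pos by (intro mult_left_mono) auto
  moreover have "0 \<le> (1 - r) * (3 * r - 2)" using r_gt r_le by simp
  ultimately show "\<beta> \<le> 2 * r - 1"
    by (intro \<beta>_le) (simp add: power2_eq_square algebra_simps)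
  \<comment> \<open>Certificate for the cubic: two products nonnegative on the range of
    \<open>r\<close> and a linear remainder positive beyond \<open>7 / 10\<close>. The last bound is
    proved likewise.\<close>
  have "0 \<le> r * (r - 3 / 4)\<^sup>2" using r_pos by simp
  with r7 r_gt have *: "0 \<le> 78 * (r * (r - 3 / 4)\<^sup>2) + 58 * ((r - 7 / 10) * (1 - r))
      + (541 / 40 * r - 94 / 10)"
    by simp
  have "(26 / 25 * r - 1 / 3) * (2 + r\<^sup>2) - 2 * r\<^sup>2
      = (78 * (r * (r - 3 / 4)\<^sup>2) + 58 * ((r - 7 / 10) * (1 - r)) + (541 / 40 * r - 94 / 10)) / 75"
    by (simp add: power2_eq_square field_simps)
  also have "0 \<le> \<dots>" using * by (intro divide_nonneg_nonneg) auto
  finally have "2 * r\<^sup>2 \<le> (26 / 25 * r - 1 / 3) * (2 + r\<^sup>2)" by (simp only: diff_ge_0_iff_ge)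
  then have "\<beta> \<le> 26 / 25 * r - 1 / 3" by (rule \<beta>_le)
  then show "\<beta> \<le> r - 1 / 3 + r / 25" by simp
  have "0 \<le> ((r - 7 / 10) * (1 - r)) * (r + 17 / 10)" using r7 r_pos by simp
  with r7 r_gt have *: "0 \<le> 53 * (((r - 7 / 10) * (1 - r)) * (r + 17 / 10))
      + 75 * ((r - 7 / 10) * (1 - r)) + (5043 / 100 * r - 3443 / 100)"
    by simp
  \<comment> \<open>Here \<open>49 / 25\<close> is \<open>2 - 1 / 25\<close>, with
    \<open>1 / 25\<close> the bonus in \<open>transfer\<close>; the denominators \<open>4\<close>
    and \<open>r\<close> are cleared.\<close>
  have "3 * ((49 / 25 * r - 1) * (2 + r\<^sup>2)) - 8 * r ^ 3
      = (53 * (((r - 7 / 10) * (1 - r)) * (r + 17 / 10))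
        + 75 * ((r - 7 / 10) * (1 - r)) + (5043 / 100 * r - 3443 / 100)) / 25"
    by (simp add: power2_eq_square power3_eq_cube field_simps)
  also have "0 \<le> \<dots>" using * by (intro divide_nonneg_nonneg) auto
  finally have "8 * r ^ 3 \<le> 3 * ((49 / 25 * r - 1) * (2 + r\<^sup>2))"
    by (simp only: diff_ge_0_iff_ge)
  then have "2 * r\<^sup>2 \<le> 3 / 4 * (49 / 25 - 1 / r) * (2 + r\<^sup>2)"
    using r_pos by (simp add: field_simps power2_eq_square power3_eq_cube)
  then have "\<beta> \<le> 3 / 4 * (49 / 25 - 1 / r)" by (rule \<beta>_le)
  then show "4 / 3 * \<beta> \<le> 2 - 1 / r - 1 / 25" by simp
qed

lemma poor_subset: "poor \<subseteq> A"
  by (auto simp: poor_def)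

text \<open>One lacking neighbour makes \<open>missing y\<close> at least \<open>w y\<close>, and
  two incoming payments raise the balance to \<open>2 / 3 * w y\<close>; a poor vertex has
  neither.\<close>

lemma poorD:
  assumes y: "y \<in> poor"
  shows "balance y < \<beta> * w y" "u y + J y = k" "J y \<le> 1" "slack y - pay y deficit / 3 < \<beta> * w y"
proof -
  have yA: "y \<in> A" and w: "0 < w y" using y poor_subset w_pos by auto
  have lt: "balance y + missing y < \<beta> * w y" using y by (simp add: poor_def)
  have d: "0 \<le> deficit y" "w y - slack y \<le> deficit y" "pay y deficit \<le> slack y" "0 \<le> slack y"
    using deficit_bounds[of y] pay_deficit_le[OF yA] slack_nonneg[OF yA] by auto
  have Jd: "0 \<le> real (J y) * deficit y" using d by simp
  have \<beta>w: "\<beta> * w y \<le> 2 / 3 * w y" using \<beta>_bounds(1) w by (intro mult_right_mono) auto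
  show eq: "u y + J y = k"
  proof (rule ccontr)
    assume "u y + J y \<noteq> k"
    then have "1 \<le> real k - real (u y) - real (J y)" using u_J_le[OF yA] by linarith
    then have "1 * w y \<le> missing y" unfolding missing_def using w by (intro mult_right_mono) auto
    moreover have "0 \<le> balance y" using d Jd by (simp add: balance_def)
    ultimately show False using lt \<beta>w w by linarith
  qed
  then have "missing y = 0" by (auto simp: missing_def)
  then show bal: "balance y < \<beta> * w y" using lt by simp
  show "J y \<le> 1"
  proof (rule ccontr)
    assume "\<not> J y \<le> 1"
    then have "2 * deficit y \<le> real (J y) * deficit y" using d by (intro mult_right_mono) auto
    then have "2 / 3 * w y \<le> balance y" using d by (simp add: balance_def)
    then show False using bal \<beta>w by linarith
  qed
  show "slack y - pay y deficit / 3 < \<beta> * w y"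
    using bal Jd by (simp add: balance_def)
qed

lemma heavyD:
  assumes "y \<in> A" "b \<in> heavy y"
  shows "b \<in> P y" "b \<in> A" "0 < w y" "0 < w b" "w b \<le> w y" "r * w y < w b" "b \<noteq> y"
    "0 \<le> deficit b" "deficit b \<le> w b"
proof -
  show b: "b \<in> P y" "r * w y < w b" using assms by (auto simp: heavy_def)
  then show "b \<in> A" using P_subset by blast
  then show "0 < w y" "0 < w b" "0 \<le> deficit b" "deficit b \<le> w b"
    using assms w_pos deficit_bounds by auto
  show "w b \<le> w y" "b \<noteq> y" using b P_weight_le by auto
qed

lemma P_deficit: "b \<in> P y \<Longrightarrow> 0 \<le> deficit b \<and> deficit b \<le> w b"
  using deficit_bounds P_subset by blast

text \<open>The two sides differ by \<open>c * (w y - w b) * (w b - deficit b)\<close> for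
  \<open>c = 1 / 3\<close> and \<open>c = 1 / 2\<close>.\<close>

lemma net_term_ge:
  assumes "b \<in> P y"
  shows "2 / 3 * (w b * deficit b) + 2 / 3 * (w b * (w y - w b))
    \<le> w b * deficit b + w b * (w y - w b) - 1 / 3 * w y * deficit b"
    "1 / 2 * (w b * deficit b) + 1 / 2 * (w b * (w y - w b))
    \<le> w b * deficit b + w b * (w y - w b) - 1 / 2 * w y * deficit b"
proof -
  have "0 \<le> (w y - w b) * (w b - deficit b)"
    using P_deficit[OF assms] P_weight_le[OF assms] by simp
  then show "2 / 3 * (w b * deficit b) + 2 / 3 * (w b * (w y - w b))
    \<le> w b * deficit b + w b * (w y - w b) - 1 / 3 * w y * deficit b"
    "1 / 2 * (w b * deficit b) + 1 / 2 * (w b * (w y - w b))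
    \<le> w b * deficit b + w b * (w y - w b) - 1 / 2 * w y * deficit b"
    by (simp_all add: algebra_simps)
qed

lemma cross_nonneg: "b \<in> P y \<Longrightarrow> 0 \<le> w b * (w y - w b)"
  using P_weight_le P_weight_pos by (simp add: less_imp_le)

text \<open>In \<open>net_slack_ge\<close> only the term of \<open>b\<close> is kept. The bound
  limits the loss \<open>reserve y / (3 * w b)\<close> in \<open>balance_chain\<close>.\<close>

lemma poor_reserve_le:
  assumes y: "y \<in> poor" and b: "b \<in> heavy y"
  shows "reserve y \<le> \<beta> * (w y)\<^sup>2 - w b * (w y - w b)"
proof -
  have yA: "y \<in> A" using y poor_subset by blast
  note h = heavyD[OF yA b]
  let ?\<phi> = "\<lambda>b. w b * deficit b + w b * (w y - w b) - 1 / 3 * w y * deficit b"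
  have "0 \<le> ?\<phi> c" if "c \<in> P y" for c
  proof -
    have "0 \<le> w c * deficit c" using P_deficit[OF that] by (intro mult_nonneg_nonneg) auto
    then show ?thesis using net_term_ge(1)[OF that] cross_nonneg[OF that] by linarith
  qed
  then have "?\<phi> b \<le> sum ?\<phi> (P y)" using h by (intro member_le_sum) auto
  moreover have "w b * (w y - w b) \<le> ?\<phi> b"
  proof -
    have "w y / 3 \<le> r * w y" using r_gt h by simp
    then have "w y / 3 \<le> w b" using h by linarith
    then have "deficit b * (w y / 3) \<le> deficit b * w b" using h by (intro mult_left_mono) auto
    then show ?thesis by (simp add: mult_ac)
  qed
  moreover have "reserve y + sum ?\<phi> (P y) \<le> w y * (slack y - 1 / 3 * pay y deficit)"
    by (rule net_slack_ge[OF yA]) auto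
  moreover have "w y * (slack y - 1 / 3 * pay y deficit) \<le> w y * (\<beta> * w y)"
    using poorD(4)[OF y] h by (intro mult_left_mono) auto
  ultimately show ?thesis by (simp add: power2_eq_square mult_ac)
qed

text \<open>Keeping two thirds of every \<open>w c * deficit c\<close> turns the reserve into two
  thirds of the gap. A winner's gap is then at most \<open>r * w b * w y\<close> too, as
  \<open>reserve_ge\<close> requires.\<close>

lemma poor_gap_le:
  assumes y: "y \<in> poor" and b: "b \<in> heavy y"
  shows "gap y \<le> r * w b * w y"
proof -
  have yA: "y \<in> A" using y poor_subset by blast
  note h = heavyD[OF yA b]
  let ?\<phi> = "\<lambda>b. w b * deficit b + w b * (w y - w b) - 1 / 3 * w y * deficit b"
  have "2 / 3 * (w b * (w y - w b)) \<le> (\<Sum>c\<in>P y. 2 / 3 * (w c * (w y - w c)))"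
    using h cross_nonneg
    by (intro member_le_sum[of b "P y" "\<lambda>c. 2 / 3 * (w c * (w y - w c))"]) auto
  then have "2 / 3 * (\<Sum>c\<in>P y. w c * deficit c) + 2 / 3 * (w b * (w y - w b)) \<le> sum ?\<phi> (P y)"
    using sum_mono[of "P y" "\<lambda>c. 2 / 3 * (w c * deficit c) + 2 / 3 * (w c * (w y - w c))" ?\<phi>]
      net_term_ge(1) by (simp add: sum.distrib sum_distrib_left)
  moreover have "reserve y + sum ?\<phi> (P y) \<le> w y * (slack y - 1 / 3 * pay y deficit)"
    by (rule net_slack_ge[OF yA]) auto
  moreover have "w y * (slack y - 1 / 3 * pay y deficit) \<le> w y * (\<beta> * w y)"
    using poorD(4)[OF y] h by (intro mult_left_mono) auto
  moreover have "3 * \<beta> * (w y)\<^sup>2 \<le> 2 * r * (w y)\<^sup>2"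
    using \<beta>_bounds(2) by (intro mult_right_mono) auto
  moreover have "r * w y * (w y - w b) \<le> w b * (w y - w b)"
    using h by (intro mult_right_mono) auto
  ultimately show ?thesis
    using reserve_nonneg[OF yA] by (simp add: reserve_def power2_eq_square algebra_simps)
qed

text \<open>Used with \<open>x = w b\<close>, \<open>z = w y\<close>, \<open>q = reserve y\<close>.
  After scaling by \<open>z\<close> the extreme case is \<open>x = z\<close>, which is the last of
  the \<open>\<beta>_bounds\<close>.\<close>

lemma heavy_weight_bound:
  assumes x: "r * z < x" "x \<le> z" "0 < z" and q: "q \<le> \<beta> * z\<^sup>2 - x * (z - x)"
  shows "x\<^sup>2 / (r * z) + q / (3 * x) \<le> (49 / 25 - \<beta>) * x"
proof -
  define t where "t = x / z"
  have t: "x = t * z" "r < t" "t \<le> 1" using x by (auto simp: t_def field_simps)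
  have t0: "0 < t" using t r_pos by simp
  have "\<beta> * (1 + t) \<le> 2 / 3 * (1 + t)" using \<beta>_bounds(1) t0 by (intro mult_right_mono) auto
  moreover have "7 / 10 \<le> t\<^sup>2 / r"
  proof -
    have "7 / 10 * r \<le> t * t" using r_gt t t0 r_pos by (intro mult_mono) auto
    then show ?thesis using r_pos by (simp add: field_simps power2_eq_square)
  qed
  \<comment> \<open>This product is \<open>(1 / r + \<beta> / 3) * t^2\<close> minus the cubic to be
    bounded.\<close>
  ultimately have "0 \<le> (1 - t) * (t\<^sup>2 / r - (\<beta> * (1 + t) - t) / 3)"
    using t t0 by (intro mult_nonneg_nonneg) auto
  moreover have "(1 / r + \<beta> / 3) * t\<^sup>2 \<le> (49 / 25 - \<beta>) * t\<^sup>2"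
    using \<beta>_bounds(6) by (intro mult_right_mono) auto
  ultimately have "t ^ 3 / r + (\<beta> - t * (1 - t)) / 3 \<le> (49 / 25 - \<beta>) * t\<^sup>2"
    by (simp add: power2_eq_square power3_eq_cube algebra_simps add_divide_distrib diff_divide_distrib)
  then have "(t ^ 3 / r + (\<beta> - t * (1 - t)) / 3) * (z / t) \<le> (49 / 25 - \<beta>) * t\<^sup>2 * (z / t)"
    using t0 x by (intro mult_right_mono) auto
  moreover have "q / (3 * x) \<le> (\<beta> * z\<^sup>2 - x * (z - x)) / (3 * x)"
    using q t t0 x by (intro divide_right_mono) auto
  moreover have "(\<beta> * z\<^sup>2 - x * (z - x)) / (3 * x) = (\<beta> - t * (1 - t)) / 3 * (z / t)"
    using t0 x(3) unfolding t(1) by (simp add: field_simps power2_eq_square)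
  moreover have "x\<^sup>2 / (r * z) = t ^ 3 / r * (z / t)"
    using t0 x(3) r_pos unfolding t(1) by (simp add: field_simps power2_eq_square power3_eq_cube)
  moreover have "(49 / 25 - \<beta>) * t\<^sup>2 * (z / t) = (49 / 25 - \<beta>) * x"
    using t0 unfolding t(1) by (simp add: field_simps power2_eq_square)
  ultimately show ?thesis unfolding distrib_right by linarith
qed

text \<open>The deficit part of the transfer is at most \<open>- 2 / 3 * deficit b\<close> and
  cancels the deficit lost in \<open>balance_chain\<close>.\<close>

lemma balance_after_transfer:
  assumes y: "y \<in> poor" and b: "b \<in> heavy y"
  shows "\<beta> * w b \<le> balance b - transfer y b"
proof -
  have yA: "y \<in> A" using y poor_subset by blast
  note h = heavyD[OF yA b]
  have "0 < r * w y" using r_pos h by simp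
  then have "1 \<le> w b / (r * w y)" using h by simp
  then have "2 / 3 \<le> w b / (r * w y) - 1 / 3" by linarith
  then have "deficit b * (2 / 3) \<le> deficit b * (w b / (r * w y) - 1 / 3)"
    using h(8) by (rule mult_left_mono)
  moreover have "(w b)\<^sup>2 / (r * w y) + reserve y / (3 * w b) \<le> (49 / 25 - \<beta>) * w b"
    by (rule heavy_weight_bound[OF _ _ _ poor_reserve_le[OF y b]]) (use h in auto)
  ultimately show ?thesis
    using balance_chain[OF yA h(1)] by (simp add: transfer_def algebra_simps)
qed

text \<open>With \<open>x = w b / (r * w y) \<le> 1\<close> the term equals
  \<open>(w b - deficit b) * (1 - x) + deficit b * (1 - c)\<close>.\<close>

lemma scaled_term_nonneg:
  assumes y: "y \<in> A" and b: "b \<in> P y" and light: "w b \<le> r * w y" and c: "c \<le> 1 / 2"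
  shows "0 \<le> w b - (w b)\<^sup>2 / (r * w y) + deficit b * (w b / (r * w y) - c)"
proof -
  have "0 < r * w y" using r_pos w_pos[OF y] by simp
  then have "w b / (r * w y) \<le> 1" using light by simp
  then have "0 \<le> (w b - deficit b) * (1 - w b / (r * w y)) + deficit b * (1 - c)"
    using P_deficit[OF b] c by (intro add_nonneg_nonneg mult_nonneg_nonneg) auto
  then show ?thesis by (simp add: power2_eq_square algebra_simps)
qed

text \<open>In \<open>net_slack_ge_scaled\<close> the light terms are nonnegative, the transfers
  refund the terms of \<open>led\<close>, and the reserve covers the heavy vertices led by
  others.\<close>

lemma poor_balance_ge:
  assumes y: "y \<in> poor" and led: "led \<subseteq> heavy y"
    and l: "\<And>b. b \<in> heavy y - led \<Longrightarrow>
      l b \<in> A \<and> l b \<noteq> y \<and> b \<in> P (l b) \<and> gap (l b) \<le> gap y"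
  shows "(1 - 1 / r + real (u y) * (1 - r)) * w y + real (J y) * deficit y / 3 + (\<Sum>b\<in>led. w b / 25)
    \<le> balance y + (\<Sum>b\<in>led. transfer y b)"
proof -
  have yA: "y \<in> A" using y poor_subset by blast
  have w: "0 < w y" "0 < r * w y" using w_pos[OF yA] r_pos by auto
  define g where "g = (\<lambda>b. w b - (w b)\<^sup>2 / (r * w y) + deficit b * (w b / (r * w y) - 1 / 3))"
  define B where "B = heavy y - led"
  have hP: "heavy y \<subseteq> P y" by (auto simp: heavy_def)
  have fin: "finite (heavy y)" using finite_subset[OF hP finite_P] .
  have "0 \<le> sum g (P y - heavy y)"
  proof (rule sum_nonneg)
    fix b assume "b \<in> P y - heavy y"
    then show "0 \<le> g b"
      unfolding g_def by (intro scaled_term_nonneg) (use yA in \<open>auto simp: heavy_def\<close>)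
  qed
  moreover have "sum g (P y) = sum g (P y - heavy y) + (sum g B + sum g led)"
    using sum.subset_diff[OF hP finite_P, of g] sum.subset_diff[OF led fin, of g]
    by (simp add: B_def)
  moreover have "sum g led = (\<Sum>b\<in>led. w b / 25) - (\<Sum>b\<in>led. transfer y b)"
    unfolding sum_subtractf[symmetric] by (intro sum.cong) (simp_all add: g_def transfer_def)
  moreover have "0 \<le> reserve y / (r * w y) + sum g B"
  proof -
    have "(\<Sum>b\<in>B. (w b)\<^sup>2 - r * w b * w y) \<le> (\<Sum>b\<in>B. (w b)\<^sup>2 - gap (l b))"
    proof (rule sum_mono)
      fix b assume "b \<in> B"
      then show "(w b)\<^sup>2 - r * w b * w y \<le> (w b)\<^sup>2 - gap (l b)"
        using l[of b] poor_gap_le[OF y, of b] by (auto simp: B_def)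
    qed
    also have "\<dots> \<le> reserve y"
      by (rule reserve_ge[OF yA]) (use hP l in \<open>auto simp: B_def\<close>)
    finally have "(\<Sum>b\<in>B. (w b)\<^sup>2 - r * w b * w y) / (r * w y) \<le> reserve y / (r * w y)"
      using w by (intro divide_right_mono) auto
    moreover have "(\<Sum>b\<in>B. (w b)\<^sup>2 - r * w b * w y) / (r * w y) = (\<Sum>b\<in>B. (w b)\<^sup>2 / (r * w y) - w b)"
      unfolding sum_divide_distrib using w r_pos by (intro sum.cong) (auto simp: field_simps)
    moreover have "(\<Sum>b\<in>B. w b - (w b)\<^sup>2 / (r * w y)) \<le> sum g B"
    proof (rule sum_mono)
      fix b assume b: "b \<in> B"
      then have "b \<in> heavy y" by (simp add: B_def)
      note h = heavyD[OF yA this]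
      have "1 \<le> w b / (r * w y)" using h w by simp
      then have "0 \<le> deficit b * (w b / (r * w y) - 1 / 3)"
        using h(8) by (intro mult_nonneg_nonneg) linarith+
      then show "w b - (w b)\<^sup>2 / (r * w y) \<le> g b" by (simp add: g_def)
    qed
    ultimately show ?thesis by (simp add: sum_subtractf)
  qed
  moreover have "(1 - 1 / r + real (u y) * (1 - r)) * w y + reserve y / (r * w y) + sum g (P y)
      \<le> slack y - 1 / 3 * pay y deficit"
    unfolding g_def by (rule net_slack_ge_scaled[OF yA r_pos]) auto
  ultimately show ?thesis by (simp add: balance_def)
qed

text \<open>Such a vertex has some heavy \<open>b\<close> and loses none of them to a competitor, so
  it collects at least one bonus \<open>w b / 25\<close>.\<close>

lemma poor_once_covered:
  assumes y: "y \<in> poor" and J: "J y = 1"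
  shows "heavy y \<noteq> {}"
    "\<lbrakk>b \<in> heavy y; l \<in> A; l \<noteq> y; b \<in> P l; gap l \<le> gap y\<rbrakk> \<Longrightarrow> False"
proof -
  have yA: "y \<in> A" using y poor_subset by blast
  have w: "0 < w y" using w_pos[OF yA] .
  \<comment> \<open>The incoming payment is at least a third of \<open>w y - slack y\<close>; this
    turns the rate \<open>1 / 3\<close> into \<open>1 / 2\<close>.\<close>
  have bal: "2 / 3 * (slack y - 1 / 2 * pay y deficit) + w y / 3 \<le> balance y"
    using deficit_bounds(3)[of y] by (simp add: balance_def J field_simps)
  note lt = poorD(1)[OF y]
  show "heavy y \<noteq> {}"
  proof
    assume e: "heavy y = {}"
    have "0 \<le> (\<Sum>b\<in>P y. w b - (w b)\<^sup>2 / (r * w y) + deficit b * (w b / (r * w y) - 1 / 2))"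
      by (intro sum_nonneg scaled_term_nonneg) (use yA e in \<open>auto simp: heavy_def not_less\<close>)
    moreover have "0 \<le> reserve y / (r * w y)" using reserve_nonneg[OF yA] r_pos w by simp
    moreover have "(1 - 1 / r + real (u y) * (1 - r)) * w y + reserve y / (r * w y)
        + (\<Sum>b\<in>P y. w b - (w b)\<^sup>2 / (r * w y) + deficit b * (w b / (r * w y) - 1 / 2))
        \<le> slack y - 1 / 2 * pay y deficit"
      by (rule net_slack_ge_scaled[OF yA r_pos]) auto
    moreover have "(\<beta> - (1 - r)) * w y \<le> (1 - 1 / r + real (u y) * (1 - r)) * w y"
    proof (rule mult_right_mono)
      have "real k = real (u y) + 1" using poorD(2)[OF y] J by simp
      then show "\<beta> - (1 - r) \<le> 1 - 1 / r + real (u y) * (1 - r)"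
        using \<beta>_le_k by (simp add: algebra_simps)
    qed (use w in simp)
    moreover have "\<beta> * w y \<le> (2 * r - 1) * w y" using \<beta>_bounds(4) w by (intro mult_right_mono) auto
    ultimately show False using bal lt by (simp add: algebra_simps)
  qed
  show False if b: "b \<in> heavy y" and l: "l \<in> A" "l \<noteq> y" "b \<in> P l" "gap l \<le> gap y"
  proof -
    note h = heavyD[OF yA b]
    let ?\<phi> = "\<lambda>b. w b * deficit b + w b * (w y - w b) - 1 / 2 * w y * deficit b"
    have "1 / 2 * (w b * (w y - w b)) \<le> (\<Sum>c\<in>P y. 1 / 2 * (w c * (w y - w c)))"
      using h cross_nonneg
      by (intro member_le_sum[of b "P y" "\<lambda>c. 1 / 2 * (w c * (w y - w c))"]) auto
    then have "1 / 2 * (\<Sum>c\<in>P y. w c * deficit c) + 1 / 2 * (w b * (w y - w b)) \<le> sum ?\<phi> (P y)"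
      using sum_mono[of "P y" "\<lambda>c. 1 / 2 * (w c * deficit c) + 1 / 2 * (w c * (w y - w c))" ?\<phi>]
        net_term_ge(2) by (simp add: sum.distrib sum_distrib_left)
    moreover have "reserve y + sum ?\<phi> (P y) \<le> w y * (slack y - 1 / 2 * pay y deficit)"
      by (rule net_slack_ge[OF yA]) auto
    moreover have "(w b)\<^sup>2 - gap l \<le> reserve y"
      using reserve_ge[OF yA, of "{b}" "\<lambda>_. l"] h l by simp
    \<comment> \<open>Reserve plus gap is at least \<open>(w b)^2\<close>, which cancels the
      negative square in \<open>w b * (w y - w b)\<close>.\<close>
    ultimately have 1: "w y * w b \<le> 2 * (w y * (slack y - 1 / 2 * pay y deficit))"
      using l(4) by (simp add: reserve_def power2_eq_square algebra_simps)
    have "w y * (2 / 3 * (slack y - 1 / 2 * pay y deficit) + w y / 3) < w y * (\<beta> * w y)"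
      using bal lt w by (intro mult_strict_left_mono) auto
    moreover have "3 * \<beta> * (w y * w y) \<le> (1 + r) * (w y * w y)"
      using \<beta>_bounds(3) by (intro mult_right_mono) auto
    moreover have "w y * (r * w y) \<le> w y * w b" using h by (intro mult_left_mono) auto
    ultimately show False using 1 by (simp add: algebra_simps)
  qed
qed

lemma poor_balance:
  assumes y: "y \<in> poor" and led: "led \<subseteq> heavy y"
    and l: "\<And>b. b \<in> heavy y - led \<Longrightarrow>
      l b \<in> A \<and> l b \<noteq> y \<and> b \<in> P (l b) \<and> gap (l b) \<le> gap y"
  shows "\<beta> * w y \<le> balance y + (\<Sum>b\<in>led. transfer y b)"
proof -
  have yA: "y \<in> A" using y poor_subset by blast
  have w: "0 < w y" using w_pos[OF yA] .
  have fin: "finite led" using led finite_P by (auto simp: heavy_def intro: finite_subset)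
  have pos: "0 \<le> w b / 25" if "b \<in> led" for b
    using heavyD[OF yA, of b] led that by auto
  note ge = poor_balance_ge[OF y led l]
  have \<beta>w: "\<beta> * w y \<le> (1 - 1 / r + real k * (1 - r)) * w y"
    using \<beta>_le_k w by (intro mult_right_mono) auto
  consider "J y = 0" | "J y = 1" using poorD(3)[OF y] by linarith
  then show ?thesis
  proof cases
    case 1
    then have "u y = k" using poorD(2)[OF y] by simp
    moreover have "0 \<le> (\<Sum>b\<in>led. w b / 25)" using pos by (rule sum_nonneg)
    ultimately show ?thesis using ge \<beta>w 1 by simp
  next
    \<comment> \<open>Now \<open>u y = k - 1\<close> costs \<open>(1 - r) * w y\<close>. The
      incoming payment, at least \<open>(2 / 3 - \<beta>) * w y\<close>, and the bonus of one led
      vertex, more than \<open>r * w y / 25\<close>, make up for it.\<close>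
    case 2
    obtain b where b: "b \<in> heavy y" using poor_once_covered(1)[OF y 2] by blast
    have bl: "b \<in> led" using poor_once_covered(2)[OF y 2 b, of "l b"] l[of b] b by blast
    have "w b / 25 \<le> (\<Sum>b\<in>led. w b / 25)"
      using bl fin pos by (intro member_le_sum[of b led "\<lambda>b. w b / 25"]) auto
    moreover have "r * w y < w b" using heavyD[OF yA b] by simp
    moreover have "(2 / 3 - \<beta>) * w y \<le> deficit y / 3"
      using poorD(1)[OF y] pay_deficit_le[OF yA] deficit_bounds(3)[of y] 2
      by (simp add: balance_def algebra_simps)
    moreover have "\<beta> * w y \<le> (r - 1 / 3 + r / 25) * w y"
      using \<beta>_bounds(5) w by (intro mult_right_mono) auto
    moreover have "real k = real (u y) + 1" using poorD(2)[OF y] 2 by simp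
    ultimately show ?thesis using ge \<beta>w 2 by (simp add: algebra_simps)
  qed
qed

section \<open>Choice of leaders and summation\<close>

definition leader :: "'a \<Rightarrow> 'a" where
  "leader b = arg_min_on gap {y \<in> poor. b \<in> heavy y}"

lemma leader:
  assumes "y \<in> poor" "b \<in> heavy y"
  shows "leader b \<in> poor" "b \<in> heavy (leader b)" "gap (leader b) \<le> gap y"
proof -
  let ?S = "{y \<in> poor. b \<in> heavy y}"
  have "finite ?S" by (rule finite_subset[OF _ finite_A]) (use poor_subset in auto)
  moreover have "?S \<noteq> {}" using assms by auto
  ultimately have "leader b \<in> ?S" "\<not> (\<exists>x\<in>?S. gap x < gap (leader b))"
    using arg_min_if_finite[of ?S gap] by (auto simp: leader_def)
  then show "leader b \<in> poor" "b \<in> heavy (leader b)" "gap (leader b) \<le> gap y"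
    using assms by (auto simp: not_less)
qed

theorem weight_bound: "weight w Opt \<le> ((real k + 1) / 2 - \<beta> / 2) * weight w A"
proof -
  define H where "H = (\<Union>y\<in>poor. heavy y)"
  define led where "led y = {b \<in> H. leader b = y}" for y
  have HA: "H \<subseteq> A" using P_subset by (fastforce simp: H_def heavy_def)
  have finH: "finite H" using HA finite_A finite_subset by blast
  have H: "leader b \<in> poor" "b \<in> heavy (leader b)" if "b \<in> H" for b
    using that leader by (auto simp: H_def)
  define gain where "gain y = (\<Sum>b\<in>led y. transfer (leader b) b)" for y
  define loss where "loss y = (if y \<in> H then transfer (leader y) y else 0)" for y
  have local: "\<beta> * w y \<le> balance y + missing y + gain y - loss y" if y: "y \<in> A" for y
  proof -
    have "0 \<le> real k - real (u y) - real (J y)" using u_J_le[OF y] by linarith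
    then have miss: "0 \<le> missing y"
      unfolding missing_def using w_pos[OF y] by simp
    have lossH: "\<beta> * w y \<le> balance y - loss y" if "y \<in> H"
      using balance_after_transfer[OF H[OF that]] that by (simp add: loss_def)
    show ?thesis
    proof (cases "y \<in> poor")
      case True
      have ledy: "led y \<subseteq> heavy y" using H by (auto simp: led_def)
      have "gain y = (\<Sum>b\<in>led y. transfer y b)" by (simp add: gain_def led_def)
      moreover have "\<beta> * w y \<le> balance y + (\<Sum>b\<in>led y. transfer y b)"
      proof (rule poor_balance[OF True ledy])
        fix b assume b: "b \<in> heavy y - led y"
        then have bH: "b \<in> H" "leader b \<noteq> y" using True by (auto simp: H_def led_def)
        have "gap (leader b) \<le> gap y" using leader(3)[OF True] b by auto
        then show "leader b \<in> A \<and> leader b \<noteq> y \<and> b \<in> P (leader b) \<and> gap (leader b) \<le> gap y"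
          using H[OF bH(1)] bH(2) poor_subset by (auto simp: heavy_def)
      qed
      \<comment> \<open>A poor \<open>y\<close> that is itself heavy for its leader still has
        \<open>\<beta> * w y\<close> after its transfer but less before, so that transfer is
        negative.\<close>
      moreover have "loss y \<le> 0"
      proof (cases "y \<in> H")
        case True
        then show ?thesis using lossH poorD(1)[OF \<open>y \<in> poor\<close>] by linarith
      qed (simp add: loss_def)
      ultimately show ?thesis using miss by linarith
    next
      case False
      then have "led y = {}" using H by (auto simp: led_def)
      then have g: "gain y = 0" by (simp add: gain_def)
      show ?thesis
      proof (cases "y \<in> H")
        case True
        then show ?thesis using lossH miss g by linarith
      next
        case notH: False
        then show ?thesis using False y g by (simp add: poor_def loss_def)
      qed
    qed
  qed
  \<comment> \<open>Each \<open>b \<in> H\<close> gives to exactly one leader, so gains and losses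
    cancel in total.\<close>
  have "(\<Sum>y\<in>A. gain y) = (\<Sum>b\<in>H. transfer (leader b) b)"
    unfolding gain_def led_def
    by (rule sum.group[OF finH finite_A]) (use H poor_subset in auto)
  moreover have "(\<Sum>y\<in>A. loss y) = (\<Sum>b\<in>H. transfer (leader b) b)"
    unfolding loss_def using HA finite_A by (simp add: sum.If_cases Int_absorb1)
  moreover have "\<beta> * weight w A \<le> (\<Sum>y\<in>A. balance y + missing y + gain y - loss y)"
    unfolding weight_def sum_distrib_left using local by (rule sum_mono)
  ultimately have "\<beta> * weight w A \<le> (\<Sum>y\<in>A. slack y + missing y)"
    by (simp add: sum.distrib sum_subtractf sum_balance)
  then show ?thesis
    using sum_slack by (simp add: missing_def algebra_simps)
qed

end

section \<open>Passage from claw-free graphs to the abstract setting\<close>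

lemma adjacent_commute: "adjacent E x y \<longleftrightarrow> adjacent E y x"
  by (simp add: adjacent_def insert_commute)

lemma card_nbhd_le:
  assumes "claw_free (k + 1) V E" "finite V" "1 \<le> k" "c \<in> V" "independent_vertices V E S"
  shows "card (nbhd E {c} S) \<le> k"
proof (rule ccontr)
  assume "\<not> card (nbhd E {c} S) \<le> k"
  then obtain L where L: "L \<subseteq> nbhd E {c} S" "card L = k + 1"
    using obtain_subset_with_card_n[of "k + 1" "nbhd E {c} S"] by auto
  have S: "S \<subseteq> V" "\<And>x y. x \<in> S \<Longrightarrow> y \<in> S \<Longrightarrow> \<not> adjacent E x y"
    using assms(5) by (auto simp: independent_vertices_def)
  show False
  proof (cases "c \<in> S")
    \<comment> \<open>A centre inside \<open>S\<close> has only itself as neighbour there, so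
      \<open>1 \<le> k\<close> gives the bound.\<close>
    case True
    then have "L \<subseteq> {c}" using L(1) S by (auto simp: nbhd_def)
    then have "card L \<le> card {c}" by (intro card_mono) auto
    then show False using L(2) assms(3) by simp
  next
    case False
    then have "L \<subseteq> S" "\<forall>v\<in>L. adjacent E c v" using L(1) by (auto simp: nbhd_def)
    moreover from this have "independent_vertices V E L"
      using S unfolding independent_vertices_def by blast
    ultimately show False using assms(1,4) L(2) unfolding claw_free_def by blast
  qed
qed

theorem theorem3:
  fixes V :: "'a set" and E :: "'a set set" and w :: "'a \<Rightarrow> real"
    and Opt A :: "'a set" and p :: "'a \<Rightarrow> 'a" and k s :: nat and \<epsilon> :: real
  assumes "1 \<le> k"
    and "finite_simple_graph V E"
    and "claw_free (k + 1) V E"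
    and "\<forall>v\<in>V. 0 < w v"
    and "max_weight_independent V E w Opt"
    and "independent_vertices V E A"
    and "\<forall>v\<in>Opt. nbhd E {v} A \<noteq> {}"
    and "max_weight_nbr E w Opt A p"
    and "1 + 2 * k * (k - 1) \<le> s"
    and "locally_optimal E w Opt A p s"
    and "0 \<le> \<epsilon>" and "\<epsilon> \<le> 1 / 2"
  shows "weight w Opt \<le>
    ((real k + 1) / 2
      - 1 / 2 * Min {2 * (1 - \<epsilon>) / (3 - \<epsilon>),
                     (real k - 1 / sqrt (1 - \<epsilon>)) * (1 - sqrt (1 - \<epsilon>)),
                     2 - 1 / sqrt (1 - \<epsilon>)}) * weight w A"
proof -
  define r where "r = sqrt (1 - \<epsilon>)"
  define \<beta> where "\<beta> = Min {2 * (1 - \<epsilon>) / (3 - \<epsilon>), (real k - 1 / r) * (1 - r), 2 - 1 / r}"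
  have fin: "finite V" using assms(2) by (simp add: finite_simple_graph_def)
  have indep: "independent_vertices V E Opt" using assms(5) by (simp add: max_weight_independent_def)
  then have sub: "Opt \<subseteq> V" "A \<subseteq> V" using assms(6) by (auto simp: independent_vertices_def)
  have r_sq: "r\<^sup>2 = 1 - \<epsilon>" using assms(12) by (simp add: r_def)
  interpret discharging A Opt "\<lambda>v. nbhd E {v} A" p w k r \<beta>
  proof
    show "finite A" "finite Opt" using sub fin finite_subset by auto
    show "nbhd E {v} A \<subseteq> A" for v by (auto simp: nbhd_def)
    show "p v \<in> nbhd E {v} A" if "v \<in> Opt" for v
      using assms(8) that by (simp add: max_weight_nbr_def)
    show "w b \<le> w (p v)" if "v \<in> Opt" "b \<in> nbhd E {v} A" for v b
      using assms(8) that by (simp add: max_weight_nbr_def)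
    show "0 < w a" if "a \<in> A" for a using assms(4) sub that by auto
    show "card (nbhd E {v} A) \<le> k" if "v \<in> Opt" for v
      using card_nbhd_le[OF assms(3) fin assms(1) _ assms(6)] sub that by auto
    \<comment> \<open>By symmetry these lie among the neighbours of \<open>a\<close> in
      \<open>Opt\<close>, to which claw-freeness at \<open>a\<close> applies.\<close>
    show "card {v \<in> Opt. a \<in> nbhd E {v} A} \<le> k" if "a \<in> A" for a
    proof -
      have "{v \<in> Opt. a \<in> nbhd E {v} A} \<subseteq> nbhd E {a} Opt"
        using adjacent_commute[of E _ a] unfolding nbhd_def by blast
      moreover have "finite (nbhd E {a} Opt)"
        by (rule finite_subset[OF _ fin]) (use sub in \<open>auto simp: nbhd_def\<close>)
      ultimately have "card {v \<in> Opt. a \<in> nbhd E {v} A} \<le> card (nbhd E {a} Opt)"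
        by (rule card_mono[rotated])
      also have "\<dots> \<le> k"
        using card_nbhd_le[OF assms(3) fin assms(1) _ indep] sub that by auto
      finally show ?thesis .
    qed
    show "sq_weight w (\<Union>y\<in>Y. charged Opt p y)
        \<le> sq_weight w (\<Union>y\<in>Y. insert y ((\<Union>v\<in>charged Opt p y. nbhd E {v} A) - {y}))"
      if Y: "Y \<subseteq> A" "Y \<noteq> {}" "card Y \<le> 1 + 2 * k * (k - 1)" for Y
    proof -
      have "finite Y" by (rule finite_subset[OF Y(1) finite_subset[OF sub(2) fin]])
      then have "1 \<le> card Y" "card Y \<le> s" using Y assms(9) by (auto simp: Suc_le_eq card_gt_0_iff)
      moreover have "closed_nbhd E Opt A p y
          = insert y ((\<Union>v\<in>charged Opt p y. nbhd E {v} A) - {y})" for y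
        by (auto simp: closed_nbhd_def nbhd_def)
      ultimately show ?thesis using assms(10) Y(1) by (simp add: locally_optimal_def)
    qed
    show "1 / 2 \<le> r\<^sup>2" using r_sq assms(12) by simp
    show "0 < r" "r \<le> 1" using assms(11,12) by (auto simp: r_def)
    \<comment> \<open>Since \<open>r^2 = 1 - \<epsilon>\<close>, this entry of the minimum is
      \<open>2 * r^2 / (2 + r^2)\<close>.\<close>
    have "\<beta> \<le> 2 * (1 - \<epsilon>) / (3 - \<epsilon>)" by (simp add: \<beta>_def)
    then show "\<beta> * (2 + r\<^sup>2) \<le> 2 * r\<^sup>2" using assms(12) unfolding r_sq by (simp add: field_simps)
    have "\<beta> \<le> (real k - 1 / r) * (1 - r)" by (simp add: \<beta>_def)
    also have "\<dots> = 1 - 1 / r + real k * (1 - r)" using \<open>0 < r\<close> by (simp add: field_simps)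
    finally show "\<beta> \<le> 1 - 1 / r + real k * (1 - r)" .
  qed
  show ?thesis using weight_bound by (simp add: \<beta>_def r_def)
qed

end
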